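(* Let $\{X_i\}_{i\in I}$ be any family of US spaces (respectively, $k_2$-Hausdorff spaces). Then $\prod_{i\in I}X_i$ with the product topology is US (respectively, $k_2$-Hausdorff).
   Context: A space $X$ is US if every convergent sequence in $X$ has a unique limit; it is $k_2$-Hausdorff if for every compact Hausdorff space $K$ and every continuous $f\colon K\to X$ the set $\{(a,b)\in K\times K:f(a)=f(b)\}$ is closed in $K\times K$. *)

theory Defs
  imports "HOL-Analysis.Analysis"
begin

definition US_space :: "'a topology \<Rightarrow> bool" where
  "US_space X \<longleftrightarrow>
     (\<forall>s :: nat \<Rightarrow> 'a. range s \<subseteq> topspace X \<and> (\<exists>l. limitin X s l sequentially)
        \<longrightarrow> (\<exists>!l. limitin X s l sequentially))"

text \<open>
  HOL cannot quantify over types inside a formula, so the type \<open>'k\<close> that carries the compact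
  Hausdorff test spaces is an explicit parameter. A space is \<open>k\<^sub>2\<close>-Hausdorff in the usual sense
  iff \<open>k2_Hausdorff_space TYPE('k)\<close> holds of it for every type \<open>'k\<close>.
\<close>

definition k2_Hausdorff_space :: "'k itself \<Rightarrow> 'a topology \<Rightarrow> bool" where
  "k2_Hausdorff_space _ X \<longleftrightarrow>
     (\<forall>(K :: 'k topology) f. compact_space K \<and> Hausdorff_space K \<and> continuous_map K X f
        \<longrightarrow> closedin (prod_topology K K)
              {(a, b). a \<in> topspace K \<and> b \<in> topspace K \<and> f a = f b})"

end

theory Submission
  imports Defs
begin

text \<open>Both properties pass to products because both are tested by maps into the space, and
  such maps are controlled coordinatewise. A limit of a sequence in the product is a limit in every
  coordinate, so uniqueness in each \<open>X i\<close> determines it. For a map \<open>f\<close>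
  from a compact Hausdorff \<open>K\<close>, the kernel {(a, b). f a = f b} is the intersection over
  \<open>i\<close> of the kernels of the coordinate maps, each closed by hypothesis on
  \<open>X i\<close>.\<close>

lemma US_space_limit_unique:
  assumes "US_space X" "range s \<subseteq> topspace X" "limitin X s l sequentially" "limitin X s l' sequentially"
  shows "l = l'"
  using assms unfolding US_space_def by blast

lemma US_space_product_topology:
  assumes "\<And>i. i \<in> I \<Longrightarrow> US_space (X i)"
  shows "US_space (product_topology X I)"
  unfolding US_space_def
proof (intro allI impI, elim conjE exE)
  fix s :: "nat \<Rightarrow> 'a \<Rightarrow> 'b" and l
  assume s: "range s \<subseteq> topspace (product_topology X I)"
    and l: "limitin (product_topology X I) s l sequentially"
  show "\<exists>!l. limitin (product_topology X I) s l sequentially"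
  proof (rule ex1I)
    show "limitin (product_topology X I) s l sequentially"
      by (fact l)
  next
    fix l' assume l': "limitin (product_topology X I) s l' sequentially"
    show "l' = l"
    \<comment> \<open>Points of the product are functions fixed to \<open>undefined\<close> off
      \<open>I\<close>, and limits are extensional too, so agreement on \<open>I\<close> suffices
      for equality.\<close>
    proof (rule extensionalityI)
      show "l' \<in> extensional I" "l \<in> extensional I"
        using l l' by (auto simp: limitin_componentwise)
      fix i assume i: "i \<in> I"
      \<comment> \<open>\<open>US_space\<close> only speaks of sequences lying in the carrier, so
        each coordinate sequence must be placed there first.\<close>
      then have "range (\<lambda>n. s n i) \<subseteq> topspace (X i)"
        using s by (auto simp: PiE_iff)
      moreover have "limitin (X i) (\<lambda>n. s n i) (l' i) sequentially"
        "limitin (X i) (\<lambda>n. s n i) (l i) sequentially"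
        using l l' i by (simp_all add: limitin_componentwise)
      ultimately show "l' i = l i"
        by (rule US_space_limit_unique[OF assms[OF i]])
    qed
  qed
qed

lemma k2_Hausdorff_space_product_topology:
  assumes "\<And>i. i \<in> I \<Longrightarrow> k2_Hausdorff_space TYPE('k) (X i)"
  shows "k2_Hausdorff_space TYPE('k) (product_topology X I)"
  unfolding k2_Hausdorff_space_def
proof (intro allI impI, elim conjE)
  fix K :: "'k topology" and f
  assume K: "compact_space K" "Hausdorff_space K"
    and f: "continuous_map K (product_topology X I) f"
  let ?E = "\<lambda>i. {(a, b). a \<in> topspace K \<and> b \<in> topspace K \<and> f a i = f b i}"
  have "closedin (prod_topology K K) (?E i)" if "i \<in> I" for i
  proof -
    have "continuous_map K (X i) (\<lambda>x. f x i)"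
      using f that by (auto simp: continuous_map_componentwise)
    then show ?thesis
      using assms[OF that] K unfolding k2_Hausdorff_space_def by blast
  qed
  \<comment> \<open>Inserting the whole space keeps the family nonempty, as
    \<open>closedin_Inter\<close> demands. For empty \<open>I\<close> the intersection is then all
    of K x K, which is the correct kernel since the product is a single point.\<close>
  then have "closedin (prod_topology K K)
      (\<Inter> (insert (topspace (prod_topology K K)) (?E ` I)))"
    by (intro closedin_Inter) (auto intro: closedin_topspace simp del: topspace_prod_topology)
  \<comment> \<open>Values of \<open>f\<close> lie in the product, hence are extensional, so
    coordinates in \<open>I\<close> separate them; this turns the kernel into the
    intersection.\<close>
  moreover have "f a = f b \<longleftrightarrow> (\<forall>i\<in>I. f a i = f b i)"
    if "a \<in> topspace K" "b \<in> topspace K" for a b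
  proof -
    have "f a \<in> extensional I" "f b \<in> extensional I"
      using f that by (auto simp: continuous_map_componentwise)
    then show ?thesis
      by (auto intro: extensionalityI)
  qed
  then have "{(a, b). a \<in> topspace K \<and> b \<in> topspace K \<and> f a = f b} =
      \<Inter> (insert (topspace (prod_topology K K)) (?E ` I))"
    by auto
  ultimately show "closedin (prod_topology K K)
      {(a, b). a \<in> topspace K \<and> b \<in> topspace K \<and> f a = f b}"
    by simp
qed

theorem proposition7p12:
  fixes X :: "'i \<Rightarrow> 'a topology" and I :: "'i set"
  shows "((\<forall>i\<in>I. US_space (X i)) \<longrightarrow> US_space (product_topology X I)) \<and>
         ((\<forall>i\<in>I. k2_Hausdorff_space TYPE('k) (X i)) \<longrightarrow>
            k2_Hausdorff_space TYPE('k) (product_topology X I))"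
  using US_space_product_topology k2_Hausdorff_space_product_topology by metis

end
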